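(* Let $S \in \mathbb{R}^{m\times n}_{\ge 0}$ be a nonnegative matrix that is not identically zero, and let $D_1\in\mathbb{R}^{m\times m}$ and $D_2\in\mathbb{R}^{n\times n}$ be diagonal matrices with positive diagonal entries. Then $$\frac{\|S\|}{\|D_1^{-1}\|\,\|D_1SD_2\|\,\|D_2^{-1}\|}\,\mathrm{hsb}(S) \;\le\; \mathrm{hsb}(D_1SD_2) \;\le\; \mathrm{hsb}(S)\,\frac{\|D_1\|\,\|S\|\,\|D_2\|}{\|D_1SD_2\|}.$$
   Context: For a real matrix $M=(m_{ij})$, $\|M\| := \max_{i,j} |m_{ij}|$. For matrices $X,Y$ of the same size, $\langle X,Y\rangle := \sum_{i,j} x_{ij}y_{ij}$. Let $\mathcal{R}_{m,n}$ denote the set of rank-one matrices in $\{0,1\}^{m\times n}$. For a nonnegative matrix $S\in\mathbb{R}^{m\times n}_{\ge 0}$ that is not identically zero, the hyperplane separation bound is $\mathrm{hsb}(S) := \|S\|^{-1}\max\{\langle S,X\rangle : X\in\mathbb{R}^{m\times n},\ \langle X,R\rangle \le 1 \text{ for all } R\in\mathcal{R}_{m,n}\}$ (equivalently, the supremum of $\langle S,X\rangle / (\|S\|\,\rho(X))$ over $X$ with $\rho(X)>0$, where $\rho(X) := \max\{\langle X,R\rangle : R\in\mathcal{R}_{m,n}\}$). *)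

theory Defs
  imports "HOL-Analysis.Analysis"
begin

definition max_norm :: "real^'n^'m \<Rightarrow> real"
  where "max_norm M = Max {\<bar>M $ i $ j\<bar> | i j. True}"

lemma max_norm_eq_infnorm: "max_norm M = infnorm M"
proof -
  have "{\<bar>M $ i $ j\<bar> | i j. True} = {\<bar>M \<bullet> b\<bar> | b. b \<in> Basis}"
  proof (intro set_eqI iffI)
    fix x assume "x \<in> {\<bar>M $ i $ j\<bar> | i j. True}"
    then obtain i j where "x = \<bar>M \<bullet> axis i (axis j 1)\<bar>" by (auto simp: inner_axis)
    then show "x \<in> {\<bar>M \<bullet> b\<bar> | b. b \<in> Basis}" by (auto simp: Basis_vec_def)
  qed (auto simp: Basis_vec_def inner_axis, blast)
  then show ?thesis
    unfolding max_norm_def infnorm_Max by (simp add: image_def Setcompr_eq_image)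
qed

definition rank_one_binary :: "(real^'n^'m) set"
  where "rank_one_binary = {R. (\<forall>i j. R $ i $ j \<in> {0, 1}) \<and> rank R = 1}"

text \<open>The library inner product on matrices is the entrywise one.\<close>

lemma matrix_inner_eq_sum:
  fixes X Y :: "real^'n^'m"
  shows "X \<bullet> Y = (\<Sum>i\<in>UNIV. \<Sum>j\<in>UNIV. X $ i $ j * Y $ i $ j)"
  by (simp add: inner_vec_def)

definition hsb_feasible :: "(real^'n^'m) set"
  where "hsb_feasible = {X. \<forall>R \<in> rank_one_binary. X \<bullet> R \<le> 1}"

text \<open>The maximum is over an infinite set, hence \<^const>\<open>Sup\<close> rather than \<^const>\<open>Max\<close>;
  \<open>hsb_attained\<close> below shows that for nonnegative \<open>S\<close> it is indeed a maximum.\<close>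

definition hsb :: "real^'n^'m \<Rightarrow> real"
  where "hsb S = inverse (max_norm S) * (SUP X \<in> hsb_feasible. S \<bullet> X)"

lemma unit_matrix_rank_one_binary:
  "axis i (axis j 1) \<in> (rank_one_binary :: (real^'n^'m) set)"
proof -
  let ?E = "axis i (axis j 1) :: real^'n^'m"
  have "rows ?E \<subseteq> span {axis j 1}"
    by (auto simp: rows_def row_def axis_def span_base span_zero vec_eq_iff cong: if_cong)
       (metis (mono_tags, lifting) axis_def insertI1 span_base span_zero vec_lambda_unique zero_index)
  then have "rank ?E \<le> 1"
    unfolding row_rank_def using dim_le_card[of "rows ?E" "{axis j 1}"] by simp
  moreover have "rank ?E \<noteq> 0" by (simp add: rank_eq_0 axis_eq_0_iff)
  ultimately show ?thesis by (auto simp: rank_one_binary_def axis_def)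
qed

lemma hsb_attained:
  fixes S :: "real^'n^'m"
  assumes nonneg: "\<And>i j. 0 \<le> S $ i $ j"
  shows "\<exists>X \<in> hsb_feasible. (\<forall>Y \<in> hsb_feasible. S \<bullet> Y \<le> S \<bullet> X)
           \<and> (SUP Y \<in> hsb_feasible. S \<bullet> Y) = S \<bullet> X"
proof -
  define K where "K = real (CARD('m) * CARD('n))"
  have K_nonneg: "0 \<le> K" by (simp add: K_def)
  define B where "B = cbox (\<chi> i j. - K) ((\<chi> i j. 1) :: real^'n^'m)"
  have le1: "X $ i $ j \<le> 1" if "X \<in> hsb_feasible" for X :: "real^'n^'m" and i j
  proof -
    have "X \<bullet> axis i (axis j 1) \<le> 1"
      using that unit_matrix_rank_one_binary unfolding hsb_feasible_def by blast
    then show ?thesis by (simp add: inner_axis)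
  qed
  have "closed (hsb_feasible :: (real^'n^'m) set)"
  proof -
    have "hsb_feasible = (\<Inter>R \<in> rank_one_binary. {X :: real^'n^'m. R \<bullet> X \<le> 1})"
      by (auto simp: hsb_feasible_def inner_commute)
    moreover have "closed \<dots>" by (intro closed_INT ballI closed_halfspace_le)
    ultimately show ?thesis by metis
  qed
  then have "compact (hsb_feasible \<inter> B)"
    unfolding B_def by (intro closed_Int_compact compact_cbox)
  moreover have "0 \<in> hsb_feasible \<inter> B"
    by (auto simp: hsb_feasible_def B_def mem_box_cart interval_cbox K_def
        cbox_def Basis_vec_def inner_axis)
  moreover have "continuous_on (hsb_feasible \<inter> B) (\<lambda>X. S \<bullet> X)"
    by (intro continuous_intros)
  ultimately obtain X where X: "X \<in> hsb_feasible \<inter> B"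
      "\<And>Y. Y \<in> hsb_feasible \<inter> B \<Longrightarrow> S \<bullet> Y \<le> S \<bullet> X"
    using continuous_attains_sup[of "hsb_feasible \<inter> B" "\<lambda>X. S \<bullet> X"] by blast
  have max: "S \<bullet> Y \<le> S \<bullet> X" if Y: "Y \<in> hsb_feasible" for Y
  proof -
    \<comment> \<open>truncating below at \<open>- K\<close> preserves feasibility and does not decrease the objective\<close>
    define Z where "Z = (\<chi> i j. max (- K) (Y $ i $ j))"
    have "Z \<bullet> R \<le> 1" if R: "R \<in> rank_one_binary" for R
    proof (cases "\<exists>i j. R $ i $ j = 1 \<and> Y $ i $ j < - K")
      case False
      have R01: "R $ i $ j = 0 \<or> R $ i $ j = 1" for i j
        using R unfolding rank_one_binary_def by auto
      have "Z $ i $ j * R $ i $ j = Y $ i $ j * R $ i $ j" for i j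
        using False R01[of i j] by (auto simp: Z_def max_def not_less)
      then have "Z \<bullet> R = Y \<bullet> R" by (simp only: matrix_inner_eq_sum)
      then show ?thesis using Y R unfolding hsb_feasible_def by auto
    next
      case True
      then obtain a b where ab: "R $ a $ b = 1" "Y $ a $ b < - K" by blast
      have R01: "R $ i $ j = 0 \<or> R $ i $ j = 1" for i j
        using R unfolding rank_one_binary_def by auto
      have "Z $ i $ j \<le> 1" for i j using le1[OF Y] by (auto simp: Z_def K_def max_def)
          (smt (verit) of_nat_0_le_iff mult_nonneg_nonneg)
      then have le: "Z $ i $ j * R $ i $ j \<le> 1" for i j using R01[of i j] by auto
      have "Z \<bullet> R = (\<Sum>(i,j)\<in>UNIV. Z $ i $ j * R $ i $ j)"
        by (simp add: matrix_inner_eq_sum sum.cartesian_product UNIV_Times_UNIV)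
      also have "\<dots> = Z $ a $ b * R $ a $ b + (\<Sum>(i,j)\<in>UNIV - {(a,b)}. Z $ i $ j * R $ i $ j)"
        by (subst sum.remove[of _ "(a,b)"]) auto
      also have "\<dots> \<le> - K + (\<Sum>p\<in>(UNIV :: ('m \<times> 'n) set) - {(a,b)}. 1)"
        using ab le by (intro add_mono sum_mono) (auto simp: Z_def)
      also have "\<dots> \<le> 1" by (simp add: K_def card_Diff_subset of_nat_diff)
      finally show ?thesis .
    qed
    then have "Z \<in> hsb_feasible" by (simp add: hsb_feasible_def)
    moreover from this have "Z \<in> B"
      using le1[OF Y] K_nonneg by (auto simp: B_def cbox_def Basis_vec_def inner_axis Z_def)
    moreover have "S \<bullet> Y \<le> S \<bullet> Z"
      unfolding matrix_inner_eq_sum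
      by (intro sum_mono mult_left_mono nonneg) (simp add: Z_def)
    ultimately show ?thesis using X(2)[of Z] by auto
  qed
  moreover have "(SUP Y \<in> hsb_feasible. S \<bullet> Y) = S \<bullet> X"
    by (rule cSup_eq_maximum) (use X max in auto)
  ultimately show ?thesis using X by blast
qed

end

theory Submission
  imports Defs
begin

text \<open>
  For weights \<open>d\<close>, \<open>e\<close> in the unit cube, the form \<open>\<Sum>i j. d i * e j * X i j\<close> is affine in each
  coordinate, so it is maximal at 0/1 vectors, where it is the inner product of \<open>X\<close> with a binary
  matrix of rank at most one. Hence rescaling rows and columns by factors in \<open>[0, 1]\<close> preserves
  feasibility. Moving \<open>D1\<close> and \<open>D2\<close> from the objective to the feasible point gives the upper
  bound; the lower bound is the upper bound for \<open>D1 ** S ** D2\<close> rescaled by the inverses.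
\<close>

lemma abs_entry_le_max_norm: "\<bar>M $ i $ j\<bar> \<le> max_norm M"
proof -
  have "{\<bar>M $ i $ j\<bar> | i j. True} = (\<lambda>(i, j). \<bar>M $ i $ j\<bar>) ` UNIV"
    by auto
  then have "finite {\<bar>M $ i $ j\<bar> | i j. True}" by simp
  then show ?thesis unfolding max_norm_def by (rule Max_ge) blast
qed

text \<open>In rank one a nonzero row spans all rows. If that row has a 1 in column
  \<open>b\<close>, then comparing column \<open>b\<close> shows that the multiplier for row
  \<open>i\<close> is \<open>R $ i $ b\<close>, itself an entry of \<open>R\<close> and hence 0 or
  1.\<close>

lemma rank_one_binary_imp_outer_product:
  fixes R :: "real^'n^'m"
  assumes "R \<in> rank_one_binary"
  obtains u v where "\<And>i. u i \<in> {0, 1}" "\<And>j. v j \<in> {0, 1}" "\<And>i j. R $ i $ j = u i * v j"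
proof -
  have R01: "R $ i $ j \<in> {0, 1}" for i j
    using assms by (auto simp: rank_one_binary_def)
  have rank: "rank R = 1"
    using assms by (simp add: rank_one_binary_def)
  then have "R \<noteq> 0" by (metis rank_eq_0 zero_neq_one)
  then obtain a b where "R $ a $ b \<noteq> 0" by (auto simp: vec_eq_iff)
  then have ab: "R $ a $ b = 1" using R01[of a b] by simp
  then have "R $ a \<noteq> 0" by (metis zero_index zero_neq_one)
  \<comment> \<open>\<open>{R $ a}\<close> is independent and its cardinality equals the dimension
    of the row space, so it spans.\<close>
  then have "rows R \<subseteq> span {R $ a}"
    using rank unfolding row_rank_def
    by (intro card_ge_dim_independent) (auto simp: rows_def row_def)
  moreover have "R $ i \<in> rows R" for i
    by (auto simp: rows_def row_def)
  ultimately have "\<exists>c. R $ i = c *\<^sub>R R $ a" for i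
    by (auto simp: span_singleton)
  then have "R $ i $ j = R $ i $ b * R $ a $ j" for i j
    by (metis ab mult.right_neutral real_scaleR_def vector_scaleR_component)
  then show ?thesis
    using that[of "\<lambda>i. R $ i $ b" "\<lambda>j. R $ a $ j"] R01 by blast
qed

lemma outer_product_in_rank_one_binary:
  fixes R :: "real^'n^'m"
  assumes "\<And>i. u i \<in> {0, 1}" "\<And>j. v j \<in> {0, 1}" "\<And>i j. R $ i $ j = u i * v j" "R \<noteq> 0"
  shows "R \<in> rank_one_binary"
proof -
  have "row i R = u i *\<^sub>R (\<chi> j. v j)" for i
    by (simp add: vec_eq_iff row_def assms(3))
  then have "rows R \<subseteq> span {\<chi> j. v j}"
    by (auto simp: rows_def intro: span_base span_scale)
  then have "rank R \<le> 1"
    unfolding row_rank_def using dim_le_card[of "rows R" "{\<chi> j. v j}"] by simp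
  moreover have "rank R \<noteq> 0" using assms(4) by (simp add: rank_eq_0)
  moreover have "R $ i $ j \<in> {0, 1}" for i j
    using assms(1)[of i] assms(2)[of j] by (auto simp: assms(3))
  ultimately show ?thesis by (auto simp: rank_one_binary_def)
qed

text \<open>A linear form on the unit cube is maximal at the vertex that selects exactly the
  positive coefficients.\<close>

lemma sum_weighted_le_binary:
  fixes c d :: "'a \<Rightarrow> real"
  assumes "\<And>i. 0 \<le> d i" "\<And>i. d i \<le> 1"
  shows "(\<Sum>i\<in>A. d i * c i) \<le> (\<Sum>i\<in>A. of_bool (0 < c i) * c i)"
proof (rule sum_mono)
  fix i
  show "d i * c i \<le> of_bool (0 < c i) * c i"
    using assms[of i] mult_right_mono[of "d i" 1 "c i"] by (auto simp: mult_nonneg_nonpos not_less)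
qed

lemma hsb_feasible_weighted_sum_le_1:
  fixes X :: "real^'n^'m"
  assumes X: "X \<in> hsb_feasible"
    and d: "\<And>i. 0 \<le> d i" "\<And>i. d i \<le> 1" and e: "\<And>j. 0 \<le> e j" "\<And>j. e j \<le> 1"
  shows "(\<Sum>i\<in>UNIV. \<Sum>j\<in>UNIV. d i * e j * X $ i $ j) \<le> 1"
proof -
  \<comment> \<open>Rounding takes two passes: \<open>u\<close> is the best vertex for the weights
    \<open>e\<close>, and \<open>v\<close> is then the best vertex for the already rounded
    \<open>u\<close>.\<close>
  define u :: "'m \<Rightarrow> real" where "u i = of_bool (0 < (\<Sum>j\<in>UNIV. e j * X $ i $ j))" for i
  define v :: "'n \<Rightarrow> real" where "v j = of_bool (0 < (\<Sum>i\<in>UNIV. u i * X $ i $ j))" for j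
  define R :: "real^'n^'m" where "R = (\<chi> i j. u i * v j)"
  have "(\<Sum>i\<in>UNIV. \<Sum>j\<in>UNIV. d i * e j * X $ i $ j)
      = (\<Sum>i\<in>UNIV. d i * (\<Sum>j\<in>UNIV. e j * X $ i $ j))"
    by (simp add: sum_distrib_left mult.assoc)
  also have "\<dots> \<le> (\<Sum>i\<in>UNIV. u i * (\<Sum>j\<in>UNIV. e j * X $ i $ j))"
    unfolding u_def by (rule sum_weighted_le_binary[OF d])
  also have "\<dots> = (\<Sum>i\<in>UNIV. \<Sum>j\<in>UNIV. e j * (u i * X $ i $ j))"
    by (simp add: sum_distrib_left mult.left_commute)
  also have "\<dots> = (\<Sum>j\<in>UNIV. e j * (\<Sum>i\<in>UNIV. u i * X $ i $ j))"
    by (subst sum.swap) (simp add: sum_distrib_left)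
  also have "\<dots> \<le> (\<Sum>j\<in>UNIV. v j * (\<Sum>i\<in>UNIV. u i * X $ i $ j))"
    unfolding v_def by (rule sum_weighted_le_binary[OF e])
  also have "\<dots> = (\<Sum>j\<in>UNIV. \<Sum>i\<in>UNIV. X $ i $ j * R $ i $ j)"
    by (simp add: sum_distrib_left R_def mult_ac)
  also have "\<dots> = X \<bullet> R"
    unfolding matrix_inner_eq_sum by (rule sum.swap)
  also have "\<dots> \<le> 1"
  \<comment> \<open>Both roundings may select nothing. The zero matrix has rank 0, so feasibility
    does not cover it, but its inner product with \<open>X\<close> is 0.\<close>
  proof (cases "R = 0")
    case False
    then have "R \<in> rank_one_binary"
      by (intro outer_product_in_rank_one_binary[of u v]) (auto simp: u_def v_def R_def)
    then show ?thesis using X by (simp add: hsb_feasible_def)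
  qed simp
  finally show ?thesis .
qed

text \<open>Pairing the rescaled matrix with an outer product of \<open>u\<close> and
  \<open>v\<close> is a weighted sum over \<open>X\<close> with weights \<open>d i * u i\<close> and
  \<open>e j * v j\<close>, which still lie in the unit interval.\<close>

lemma hsb_feasible_scale:
  fixes X :: "real^'n^'m"
  assumes X: "X \<in> hsb_feasible"
    and d: "\<And>i. 0 \<le> d i" "\<And>i. d i \<le> 1" and e: "\<And>j. 0 \<le> e j" "\<And>j. e j \<le> 1"
  shows "(\<chi> i j. d i * e j * X $ i $ j) \<in> hsb_feasible"
  unfolding hsb_feasible_def
proof safe
  fix R :: "real^'n^'m"
  assume "R \<in> rank_one_binary"
  then obtain u v where u: "\<And>i. u i \<in> {0, 1}" and v: "\<And>j. v j \<in> {0, 1}"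
    and R: "\<And>i j. R $ i $ j = u i * v j"
    using rank_one_binary_imp_outer_product by blast
  have "0 \<le> d i * u i \<and> d i * u i \<le> 1" for i
    using u[of i] d[of i] by auto
  moreover have "0 \<le> e j * v j \<and> e j * v j \<le> 1" for j
    using v[of j] e[of j] by auto
  ultimately have "(\<Sum>i\<in>UNIV. \<Sum>j\<in>UNIV. (d i * u i) * (e j * v j) * X $ i $ j) \<le> 1"
    by (intro hsb_feasible_weighted_sum_le_1[OF X]) auto
  then show "(\<chi> i j. d i * e j * X $ i $ j) \<bullet> R \<le> 1"
    by (simp add: matrix_inner_eq_sum R mult_ac)
qed

text \<open>A maximizer for \<open>T\<close>, rescaled by \<open>d i / \<alpha>\<close> and
  \<open>e j / \<beta>\<close>, is feasible, and its pairing with \<open>S\<close> is the maximum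
  for \<open>T\<close> divided by \<open>\<alpha> * \<beta>\<close>.\<close>

lemma SUP_hsb_feasible_scale_le:
  fixes S T :: "real^'n^'m"
  assumes S: "\<And>i j. 0 \<le> S $ i $ j"
    and T: "\<And>i j. T $ i $ j = d i * e j * S $ i $ j"
    and d: "\<And>i. 0 \<le> d i" "\<And>i. d i \<le> \<alpha>" "0 < \<alpha>"
    and e: "\<And>j. 0 \<le> e j" "\<And>j. e j \<le> \<beta>" "0 < \<beta>"
  shows "(SUP X\<in>hsb_feasible. T \<bullet> X) \<le> \<alpha> * \<beta> * (SUP X\<in>hsb_feasible. S \<bullet> X)"
proof -
  have "0 \<le> T $ i $ j" for i j
    by (simp add: T S d e)
  then obtain X where X: "X \<in> hsb_feasible" "(SUP X\<in>hsb_feasible. T \<bullet> X) = T \<bullet> X"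
    using hsb_attained[of T] by blast
  define Y where "Y = (\<chi> i j. d i / \<alpha> * (e j / \<beta>) * X $ i $ j)"
  have "Y \<in> hsb_feasible"
    unfolding Y_def using d e by (intro hsb_feasible_scale[OF X(1)]) auto
  \<comment> \<open>Attainment for \<open>S\<close> also ensures that the supremum is a genuine
    upper bound.\<close>
  then have "S \<bullet> Y \<le> (SUP X\<in>hsb_feasible. S \<bullet> X)"
    using hsb_attained[OF S] by metis
  moreover have "T \<bullet> X = \<alpha> * \<beta> * (S \<bullet> Y)"
    using d(3) e(3) by (simp add: matrix_inner_eq_sum T Y_def sum_distrib_left mult_ac)
  ultimately show ?thesis
    using X(2) d(3) e(3) by simp
qed

lemma diagonal_mult_matrix_mult_diagonal_entry:
  fixes S :: "real^'n^'m"
  assumes "\<And>i j. i \<noteq> j \<Longrightarrow> D1 $ i $ j = 0" "\<And>i j. i \<noteq> j \<Longrightarrow> D2 $ i $ j = 0"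
  shows "(D1 ** S ** D2) $ i $ j = D1 $ i $ i * D2 $ j $ j * S $ i $ j"
proof -
  have "(\<Sum>k\<in>UNIV. D1 $ i $ k * S $ k $ l) = D1 $ i $ i * S $ i $ l" for l
    by (subst sum.remove[of _ i]) (auto simp: assms(1) intro!: sum.neutral)
  then have "(D1 ** S ** D2) $ i $ j = (\<Sum>l\<in>UNIV. D1 $ i $ i * S $ i $ l * D2 $ l $ j)"
    by (simp add: matrix_matrix_mult_def)
  also have "\<dots> = D1 $ i $ i * D2 $ j $ j * S $ i $ j"
    by (subst sum.remove[of _ j]) (auto simp: assms(2) intro!: sum.neutral)
  finally show ?thesis .
qed

lemma diagonal_matrix_inv_entry:
  fixes D :: "real^'n^'n"
  assumes "\<And>i j. i \<noteq> j \<Longrightarrow> D $ i $ j = 0" "\<And>i. D $ i $ i \<noteq> 0"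
  shows "matrix_inv D $ i $ i = inverse (D $ i $ i)"
proof -
  \<comment> \<open>\<open>matrix_inv\<close> is a choice operator, so a two-sided inverse must
    first be shown to exist.\<close>
  have "det D \<noteq> 0"
    using assms by (simp add: det_diagonal)
  then have "\<exists>A'. D ** A' = mat 1 \<and> A' ** D = mat 1"
    by (simp add: invertible_det_nz[symmetric] invertible_def)
  then have "D ** matrix_inv D = mat 1 \<and> matrix_inv D ** D = mat 1"
    unfolding matrix_inv_def by (rule someI_ex)
  then have "(matrix_inv D ** D) $ i $ i = 1"
    by (simp add: mat_def)
  moreover have "(matrix_inv D ** D) $ i $ i = matrix_inv D $ i $ i * D $ i $ i"
    unfolding matrix_matrix_mult_def
    by simp (subst sum.remove[of _ i], auto simp: assms(1) intro!: sum.neutral)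
  ultimately show ?thesis
    using assms(2)[of i] by (simp add: field_simps)
qed

theorem theorem3p2:
  fixes S :: "real^'n^'m" and D1 :: "real^'m^'m" and D2 :: "real^'n^'n"
  assumes "\<And>i j. S $ i $ j \<ge> 0"
    and "S \<noteq> 0"
    and "\<And>i j. i \<noteq> j \<Longrightarrow> D1 $ i $ j = 0"
    and "\<And>i. D1 $ i $ i > 0"
    and "\<And>i j. i \<noteq> j \<Longrightarrow> D2 $ i $ j = 0"
    and "\<And>i. D2 $ i $ i > 0"
  shows "max_norm S / (max_norm (matrix_inv D1) * max_norm (D1 ** S ** D2) * max_norm (matrix_inv D2))
            * hsb S \<le> hsb (D1 ** S ** D2)
       \<and> hsb (D1 ** S ** D2)
            \<le> hsb S * (max_norm D1 * max_norm S * max_norm D2 / max_norm (D1 ** S ** D2))"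
proof -
  define T where "T = D1 ** S ** D2"
  have T: "T $ i $ j = D1 $ i $ i * D2 $ j $ j * S $ i $ j" for i j
    unfolding T_def by (rule diagonal_mult_matrix_mult_diagonal_entry[OF assms(3,5)])
  have D1_ne: "D1 $ i $ i \<noteq> 0" and D2_ne: "D2 $ j $ j \<noteq> 0" for i j
    using assms(4)[of i] assms(6)[of j] by auto
  note inv1 = diagonal_matrix_inv_entry[OF assms(3) D1_ne]
    and inv2 = diagonal_matrix_inv_entry[OF assms(5) D2_ne]
  \<comment> \<open>\<open>S\<close> arises from \<open>T\<close> by the inverse scalings, so the
    same supremum estimate applies with the roles exchanged and yields the lower bound.\<close>
  have S_eq: "S $ i $ j = matrix_inv D1 $ i $ i * matrix_inv D2 $ j $ j * T $ i $ j" for i j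
    using D1_ne[of i] D2_ne[of j] by (simp add: T inv1 inv2 field_simps)
  have T_nonneg: "0 \<le> T $ i $ j" for i j
    using assms(1)[of i j] assms(4)[of i] assms(6)[of j] by (simp add: T)
  have inv_pos: "0 < matrix_inv D1 $ i $ i" "0 < matrix_inv D2 $ j $ j" for i j
    by (simp_all add: inv1 inv2 assms(4,6))
  have entry_le: "M $ i $ j \<le> max_norm M" for M :: "real^'a^'b" and i j
    using abs_entry_le_max_norm[of M i j] by linarith
  have pos: "0 < max_norm D1" "0 < max_norm D2"
    "0 < max_norm (matrix_inv D1)" "0 < max_norm (matrix_inv D2)"
    using assms(4) assms(6) inv_pos entry_le less_le_trans by metis+
  obtain a b where "S $ a $ b \<noteq> 0" using assms(2) by (auto simp: vec_eq_iff)
  then have "0 < S $ a $ b" using assms(1)[of a b] by simp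
  moreover from this have "0 < T $ a $ b" by (simp add: T assms(4,6))
  ultimately have norm_pos: "0 < max_norm S" "0 < max_norm T"
    using entry_le less_le_trans by metis+
  define s t where "s = (SUP X\<in>hsb_feasible. S \<bullet> X)" and "t = (SUP X\<in>hsb_feasible. T \<bullet> X)"
  have "t \<le> max_norm D1 * max_norm D2 * s"
    unfolding s_def t_def using assms(1,4,6) pos
    by (intro SUP_hsb_feasible_scale_le[OF _ T]) (auto simp: less_imp_le entry_le)
  then have upper: "t / max_norm T \<le> max_norm D1 * max_norm D2 * s / max_norm T"
    using norm_pos by (simp add: divide_right_mono)
  have "s \<le> max_norm (matrix_inv D1) * max_norm (matrix_inv D2) * t"
    unfolding s_def t_def using T_nonneg inv_pos pos
    by (intro SUP_hsb_feasible_scale_le[OF _ S_eq]) (auto simp: less_imp_le entry_le)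
  then have lower: "s / (max_norm (matrix_inv D1) * max_norm (matrix_inv D2)) \<le> t"
    using pos by (simp add: divide_le_eq mult_ac)
  have hsb_eq: "hsb S = s / max_norm S" "hsb T = t / max_norm T"
    by (simp_all add: hsb_def s_def t_def divide_inverse mult.commute)
  \<comment> \<open>The factor \<open>max_norm S\<close> in both bounds cancels the denominator of
    \<open>hsb S\<close>, which leaves \<open>upper\<close> and \<open>lower\<close> divided by
    \<open>max_norm T\<close>.\<close>
  show ?thesis
    unfolding T_def[symmetric] hsb_eq
    using divide_right_mono[OF lower, of "max_norm T"] upper norm_pos
    by (simp add: mult_ac)
qed

end
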